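(* The function $r\mapsto\chi_m(\mathbb{S}^2_r)$, for real $r>0$, is not monotonic.
   Context: $\mathbb{S}^2_r\subset\mathbb{R}^3$ is the 2-sphere of radius $r$ (centered at the origin), equipped with the chordal distance, i.e. the Euclidean distance of $\mathbb{R}^3$, and with the 2-dimensional spherical (surface) measure. Two points of $\mathbb{S}^2_r$ are adjacent if their chordal distance is exactly $1$. The measurable chromatic number $\chi_m(\mathbb{S}^2_r)$ is the minimum $k$ for which there is a function $\varphi:\mathbb{S}^2_r\to\{1,\dots,k\}$ such that $\varphi(u)\neq\varphi(v)$ whenever $u,v$ are adjacent and such that $\varphi^{-1}(i)$ is a measurable subset of $\mathbb{S}^2_r$ for every $i$. Monotonic means non-decreasing or non-increasing. *)

theory Defs
  imports "HOL-Analysis.Analysis" "HOL-Library.Extended_Nat"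
begin

text \<open>
  The surface measure on the sphere of radius \<open>r\<close> is obtained from Lebesgue measure on the solid ball
  by radial projection: a set \<open>A\<close> of area \<open>a\<close> spans a cone (towards the origin) of volume
  \<open>a * r / 3\<close>. The completion makes all subsets of null sets measurable, as for Lebesgue measure.
\<close>

definition sphere_borel_measure :: "real \<Rightarrow> (real^3) measure" where
  "sphere_borel_measure r =
     scale_measure (ennreal (3 / r))
       (distr (restrict_space lborel (cball 0 r - {0})) (restrict_space borel (sphere 0 r))
          (\<lambda>x. (r / norm x) *\<^sub>R x))"

definition sphere_measure :: "real \<Rightarrow> (real^3) measure" where
  "sphere_measure r = completion (sphere_borel_measure r)"

definition measurable_coloring :: "real \<Rightarrow> nat \<Rightarrow> (real^3 \<Rightarrow> nat) \<Rightarrow> bool" where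
  "measurable_coloring r k \<phi> \<longleftrightarrow>
     \<phi> \<in> sphere 0 r \<rightarrow> {1..k} \<and>
     (\<forall>u\<in>sphere 0 r. \<forall>v\<in>sphere 0 r. dist u v = 1 \<longrightarrow> \<phi> u \<noteq> \<phi> v) \<and>
     (\<forall>i\<in>{1..k}. {u \<in> sphere 0 r. \<phi> u = i} \<in> sets (sphere_measure r))"

text \<open>
  The infimum of a nonempty set of extended naturals is its minimum; the value \<open>\<infinity>\<close> would
  mean that no finite measurable coloring exists.
\<close>

definition measurable_chromatic_number :: "real \<Rightarrow> enat" where
  "measurable_chromatic_number r = Inf {enat k | k. \<exists>\<phi>. measurable_coloring r k \<phi>}"

lemma radial_projection_measurable:
  assumes "r > 0"
  shows "(\<lambda>x. (r / norm x) *\<^sub>R x) \<in>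
    measurable (restrict_space lborel (cball 0 r - {0})) (restrict_space borel (sphere (0::real^3) r))"
proof (rule measurable_restrict_space2)
  show "(\<lambda>x. (r / norm x) *\<^sub>R x) \<in> space (restrict_space lborel (cball 0 r - {0})) \<rightarrow> sphere (0::real^3) r"
    using assms by (auto simp: space_restrict_space)
  have "(\<lambda>x::real^3. (r / norm x) *\<^sub>R x) \<in> borel_measurable lborel"
    by measurable
  then show "(\<lambda>x. (r / norm x) *\<^sub>R x) \<in> restrict_space lborel (cball (0::real^3) r - {0}) \<rightarrow>\<^sub>M borel"
    by (rule measurable_restrict_space1)
qed

lemma space_sphere_measure [simp]: "space (sphere_measure r) = sphere 0 r"
  by (simp add: sphere_measure_def sphere_borel_measure_def space_restrict_space space_scale_measure)

lemma emeasure_sphere_measure: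
  assumes r: "r > 0"
  shows "emeasure (sphere_measure r) (sphere 0 r) = ennreal (4 * pi * r\<^sup>2)"
proof -
  let ?M = "restrict_space lborel (cball (0::real^3) r - {0})"
  let ?f = "\<lambda>x::real^3. (r / norm x) *\<^sub>R x"
  have s: "sphere 0 r \<in> sets (restrict_space borel (sphere (0::real^3) r))"
    using sets.top[of "restrict_space borel (sphere (0::real^3) r)"] by (simp add: space_restrict_space)
  have pre: "?f -` sphere 0 r \<inter> space ?M = cball 0 r - {0}"
    using r by (auto simp: space_restrict_space)
  have "emeasure lborel (cball (0::real^3) r - {0}) = emeasure lborel (cball (0::real^3) r)"
    by (intro emeasure_Diff_null_set) auto
  also have "\<dots> = ennreal (4 / 3 * pi * r ^ 3)"
    using r by (simp add: emeasure_cball unit_ball_vol_numeral fact_numeral)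
  finally have vol: "emeasure lborel (cball (0::real^3) r - {0}) = ennreal (4 / 3 * pi * r ^ 3)" .
  have "emeasure (distr ?M (restrict_space borel (sphere 0 r)) ?f) (sphere 0 r)
      = ennreal (4 / 3 * pi * r ^ 3)"
    using emeasure_distr[OF radial_projection_measurable[OF r] s] vol unfolding pre
    by (simp add: emeasure_restrict_space)
  moreover have "3 / r * (4 / 3 * pi * r ^ 3) = 4 * pi * r\<^sup>2"
    using r by (simp add: power2_eq_square power3_eq_cube)
  ultimately have "emeasure (sphere_borel_measure r) (sphere 0 r) = ennreal (4 * pi * r\<^sup>2)"
    using r by (simp add: sphere_borel_measure_def ennreal_mult[symmetric])
  moreover have "sphere 0 r \<in> sets (sphere_borel_measure r)"
    using s by (simp add: sphere_borel_measure_def)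
  ultimately show ?thesis
    by (simp add: sphere_measure_def)
qed

end

theory Submission imports Defs begin

text \<open>
  The chromatic number rises from \<open>1\<close> to at least \<open>2\<close> at radius \<open>1/2\<close>, where antipodal points
  become adjacent. It falls again between \<open>sqrt (3/8)\<close> and the larger radius \<open>1 / sqrt 2\<close>.
  At \<open>1 / sqrt 2\<close> adjacency is orthogonality, and the four pairs of opposite octants, with their
  boundaries distributed carefully, are a coloring with four Borel classes.
  What has to be shown is that four measurable colors are not enough at \<open>sqrt (3/8)\<close>, the
  circumradius of the regular tetrahedron of side \<open>1\<close>.

  At that radius two points are adjacent when the cosine of their angle is \<open>-1/3\<close>, and every
  point lies on a circle's worth of inscribed unit tetrahedra. With four colors each tetrahedron
  carries every color once, so its color sum is \<open>10\<close>. Hence the color of \<open>x\<close> is determined by the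
  three other vertices of a tetrahedron at \<open>x\<close>, and each of those by three vertices of a further
  tetrahedron. In this way nine points \<open>w\<close> determine the color of \<open>x\<close>
  (\<open>color_sum_two_generations\<close>). One generation of tetrahedra would only move \<open>w\<close> along a circle,
  which a null set can contain; with two generations \<open>w\<close> sweeps out an open set, so for every null
  set and for \<^emph>\<open>every\<close> \<open>x\<close> the nine points can be chosen outside it
  (\<open>tetrahedra_avoiding_null_set\<close>).

  This forces the coloring to be locally constant (\<open>color_locally_constant\<close>). Suppose points of
  other colors converge to \<open>x\<close>, and move \<open>x\<close> to them by isometries \<open>h n\<close> tending to the
  identity. A measurable coloring is almost invariant under small isometries (a form of Lusin's
  theorem), so along a fast enough sequence Borel-Cantelli yields a null set outside which
  \<open>h n\<close> eventually preserves colors. Choosing the nine points outside it, \<open>h n\<close> preserves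
  their colors and therefore that of \<open>x\<close>, a contradiction. But a locally constant function on the
  connected sphere is constant, and adjacent points have different colors.

  The argument is carried out for the coloring extended along rays from the origin to \<open>\<real>\<^sup>3\<close>, so that Lebesgue measure of \<open>\<real>\<^sup>3\<close> replaces the surface measure.
\<close>

unbundle cross3_syntax

section \<open>Rotation by a third of a turn\<close>

text \<open>
  Rodrigues' formula for the angle \<open>2 * pi / 3\<close> about the unit axis \<open>v\<close>. The tetrahedra with a vertex
  in direction \<open>v\<close> are the orbits under this rotation of single neighbours of \<open>v\<close>.
\<close>

definition rot3 :: "real^3 \<Rightarrow> real^3 \<Rightarrow> real^3" where
  "rot3 v z = - (1/2) *\<^sub>R z + (3/2 * (v \<bullet> z)) *\<^sub>R v + (sqrt 3 / 2) *\<^sub>R (v \<times> z)"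

lemma cross_cross_unit:
  assumes "norm v = 1" shows "v \<times> (v \<times> z) = (v \<bullet> z) *\<^sub>R v - z"
proof -
  have "v \<times> (v \<times> z) = (v \<bullet> z) *\<^sub>R v - (v \<bullet> v) *\<^sub>R z"
    by (simp add: cross3_simps forall_3)
  then show ?thesis using assms by (simp add: dot_square_norm)
qed

lemma linear_rot3: "linear (rot3 v)"
  by (rule linearI)
     (simp_all add: rot3_def inner_add_right cross_add_right cross_mult_right vec_eq_iff field_simps)

lemma inner_rot3_axis:
  assumes "norm v = 1" shows "v \<bullet> rot3 v z = v \<bullet> z"
  using assms by (simp add: rot3_def inner_add_right inner_diff_right dot_cross_self dot_square_norm)

lemma cross_rot3:
  assumes "norm v = 1"
  shows "v \<times> rot3 v z = - (1/2) *\<^sub>R (v \<times> z) + (sqrt 3 / 2) *\<^sub>R ((v \<bullet> z) *\<^sub>R v - z)"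
  by (simp add: rot3_def cross_add_right cross_mult_right cross_cross_unit[OF assms] Cross3.right_diff_distrib)

lemma rot3_rot3:
  assumes "norm v = 1"
  shows "rot3 v (rot3 v z) = - (1/2) *\<^sub>R z + (3/2 * (v \<bullet> z)) *\<^sub>R v - (sqrt 3 / 2) *\<^sub>R (v \<times> z)"
proof -
  have "rot3 v (rot3 v z) = - (1/2) *\<^sub>R rot3 v z + (3/2 * (v \<bullet> z)) *\<^sub>R v + (sqrt 3 / 2) *\<^sub>R (v \<times> rot3 v z)"
    by (subst rot3_def) (simp add: inner_rot3_axis[OF assms])
  also have "\<dots> = - (1/2) *\<^sub>R z + (3/2 * (v \<bullet> z)) *\<^sub>R v - (sqrt 3 / 2) *\<^sub>R (v \<times> z)"
    unfolding cross_rot3[OF assms] by (simp add: rot3_def vec_eq_iff field_simps)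
  finally show ?thesis .
qed

lemma rot3_cube:
  assumes "norm v = 1" shows "rot3 v (rot3 v (rot3 v z)) = z"
proof -
  have "rot3 v (rot3 v (rot3 v z)) = - (1/2) *\<^sub>R rot3 v z + (3/2 * (v \<bullet> z)) *\<^sub>R v - (sqrt 3 / 2) *\<^sub>R (v \<times> rot3 v z)"
    by (subst rot3_rot3[OF assms]) (simp add: inner_rot3_axis[OF assms])
  also have "\<dots> = z"
    unfolding cross_rot3[OF assms] by (simp add: rot3_def vec_eq_iff field_simps)
  finally show ?thesis .
qed

lemma inner_rot3:
  assumes "norm v = 1" shows "rot3 v y \<bullet> rot3 v z = y \<bullet> z"
proof -
  have 1: "(v \<times> y) \<bullet> (v \<times> z) = y \<bullet> z - (v \<bullet> y) * (v \<bullet> z)"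
    using assms by (simp add: dot_cross dot_square_norm inner_commute)
  have 2: "y \<bullet> (v \<times> z) = - ((v \<times> y) \<bullet> z)" 
    by (simp add: cross3_simps)
  show ?thesis using assms
    by (simp add: rot3_def inner_add_right inner_add_left inner_diff_right inner_diff_left
       dot_cross_self dot_square_norm 1 2 inner_commute[of y v] inner_commute[of z v] algebra_simps)
      
qed

text \<open>
  When the angle between \<open>v\<close> and \<open>z\<close> has cosine \<open>-1/3\<close>, this value is
  \<open>- (norm z)\<^sup>2 / 3\<close>: the orbit of \<open>z\<close> then consists of mutually adjacent directions.
\<close>

lemma inner_self_rot3: "z \<bullet> rot3 v z = - (norm z)\<^sup>2 / 2 + 3/2 * (v \<bullet> z)\<^sup>2"
  by (simp add: rot3_def inner_add_right inner_diff_right dot_cross_self dot_square_norm power2_eq_square inner_commute)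

lemma orthogonal_transformation_rot3:
  "norm v = 1 \<Longrightarrow> orthogonal_transformation (rot3 v)"
  by (simp add: orthogonal_transformation_def linear_rot3 inner_rot3)

section \<open>The two common neighbours of two directions\<close>

text \<open>
  The directions \<open>z\<close> for which a tetrahedral neighbour of both \<open>x\<close> and \<open>z\<close> exists and is not
  coplanar with them. If \<open>\<alpha>\<close> is the tetrahedral angle, with cosine \<open>-1/3\<close>, the extreme position of \<open>z\<close>
  makes the angle \<open>2 * pi - 2 * \<alpha>\<close> with \<open>x\<close>, whose cosine is \<open>2/9 - 1 = -7/9\<close>.
\<close>

definition common_nbr_dom :: "real^3 \<Rightarrow> (real^3) set" where
  "common_nbr_dom x = {z. -7 * norm z < 9 * (x \<bullet> z) \<and> x \<bullet> z < norm z}"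

text \<open>
  A common neighbour is the sum of a vector in the plane of \<open>x\<close> and \<open>z\<close>, which is fixed by the two
  inner products, and a multiple of \<open>x \<times> z\<close>, which is fixed up to sign by the norm. In
  \<open>common_nbr\<close> the parameter \<open>\<sigma>\<close> is that sign.
\<close>

definition common_nbr_mid :: "real^3 \<Rightarrow> real^3 \<Rightarrow> real^3" where
  "common_nbr_mid x z = - (1 / (3 * (norm z + x \<bullet> z))) *\<^sub>R (norm z *\<^sub>R x + z)"

definition common_nbr_height :: "real^3 \<Rightarrow> real^3 \<Rightarrow> real" where
  "common_nbr_height x z = sqrt ((7 * norm z + 9 * (x \<bullet> z)) /
     (9 * (norm z + x \<bullet> z) * ((norm z)\<^sup>2 - (x \<bullet> z)\<^sup>2)))"

definition common_nbr :: "real^3 \<Rightarrow> real \<Rightarrow> real^3 \<Rightarrow> real^3" where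
  "common_nbr x \<sigma> z = common_nbr_mid x z + (\<sigma> * common_nbr_height x z) *\<^sub>R (x \<times> z)"

lemma common_nbr_domD:
  assumes "z \<in> common_nbr_dom x"
  shows "z \<noteq> 0" "0 < norm z + x \<bullet> z" "0 < (norm z)\<^sup>2 - (x \<bullet> z)\<^sup>2" "0 < 7 * norm z + 9 * (x \<bullet> z)"
proof -
  have *: "-7 * norm z < 9 * (x \<bullet> z)" "x \<bullet> z < norm z"
    using assms by (auto simp: common_nbr_dom_def)
  show "z \<noteq> 0" using * by auto
  show p: "0 < norm z + x \<bullet> z" using * by (smt (verit) norm_ge_zero)
  have "0 < (norm z + x \<bullet> z) * (norm z - x \<bullet> z)"
    using p *(2) by simp
  then show "0 < (norm z)\<^sup>2 - (x \<bullet> z)\<^sup>2" by (simp add: power2_eq_square algebra_simps)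
  show "0 < 7 * norm z + 9 * (x \<bullet> z)" using * by simp
qed

lemma open_common_nbr_dom: "open (common_nbr_dom x)"
  unfolding common_nbr_dom_def by (intro open_Collect_conj open_Collect_less continuous_intros)

lemma common_nbr_mid_inner:
  assumes x: "norm x = 1" and z: "z \<in> common_nbr_dom x"
  shows "common_nbr_mid x z \<bullet> x = - 1/3" "common_nbr_mid x z \<bullet> z = - norm z / 3"
    "common_nbr_mid x z \<bullet> (x \<times> z) = 0"
    "\<And>v. v \<bullet> x = - 1/3 \<Longrightarrow> v \<bullet> z = - norm z / 3 \<Longrightarrow>
        v \<bullet> common_nbr_mid x z = 2 * norm z / (9 * (norm z + x \<bullet> z))"
proof -
  note pos = common_nbr_domD[OF z]
  have "common_nbr_mid x z \<bullet> x = - ((norm z + x \<bullet> z) / (3 * (norm z + x \<bullet> z)))"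
    using x by (simp add: common_nbr_mid_def inner_add_left dot_square_norm inner_commute[of _ x] inner_add_right)
  then show "common_nbr_mid x z \<bullet> x = - 1/3" using pos by simp
  have "common_nbr_mid x z \<bullet> z = - ((norm z * (norm z + x \<bullet> z)) / (3 * (norm z + x \<bullet> z)))"
    by (simp add: common_nbr_mid_def inner_add_left dot_square_norm power2_eq_square
        distrib_left distrib_right)
       (simp add: add_divide_distrib)
  moreover have "a * m / (3 * m) = a / 3" if "m \<noteq> 0" for a m :: real
    using that by simp
  ultimately show "common_nbr_mid x z \<bullet> z = - norm z / 3"
    using pos(2) by (metis less_irrefl minus_divide_left)
  show "common_nbr_mid x z \<bullet> (x \<times> z) = 0"
    by (simp add: common_nbr_mid_def inner_add_left dot_cross_self)
  show "v \<bullet> common_nbr_mid x z = 2 * norm z / (9 * (norm z + x \<bullet> z))"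
    if "v \<bullet> x = - 1/3" "v \<bullet> z = - norm z / 3" for v
    using that by (simp add: common_nbr_mid_def inner_add_right)
qed

lemma inner_cross_self_unit:
  assumes "norm x = 1"
  shows "(x \<times> z) \<bullet> (x \<times> z) = (norm z)\<^sup>2 - (x \<bullet> z)\<^sup>2"
  using assms norm_cross[of x z] by (simp add: dot_square_norm)

lemma common_nbr_height_sq:
  assumes "z \<in> common_nbr_dom x"
  shows "(common_nbr_height x z)\<^sup>2 * ((norm z)\<^sup>2 - (x \<bullet> z)\<^sup>2) =
    1 - 2 * norm z / (9 * (norm z + x \<bullet> z))"
proof -
  note pos = common_nbr_domD[OF assms]
  define D where "D = (norm z)\<^sup>2 - (x \<bullet> z)\<^sup>2"
  have "(common_nbr_height x z)\<^sup>2 = (7 * norm z + 9 * (x \<bullet> z)) / (9 * (norm z + x \<bullet> z) * D)"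
    using pos by (simp add: common_nbr_height_def D_def)
  moreover have "D > 0" using pos by (simp add: D_def)
  ultimately have "(common_nbr_height x z)\<^sup>2 * D = (7 * norm z + 9 * (x \<bullet> z)) / (9 * (norm z + x \<bullet> z))"
    by simp
  also have "\<dots> = 1 - 2 * norm z / (9 * (norm z + x \<bullet> z))"
    using pos(2) by (simp add: field_simps)
  finally show ?thesis by (simp add: D_def)
qed

lemma common_nbr_adjacent:
  assumes x: "norm x = 1" and z: "z \<in> common_nbr_dom x" and \<sigma>: "\<sigma>\<^sup>2 = 1"
  shows "norm (common_nbr x \<sigma> z) = 1" "x \<bullet> common_nbr x \<sigma> z = -1/3" "common_nbr x \<sigma> z \<bullet> z = - norm z / 3"
proof -
  note mid = common_nbr_mid_inner[OF x z]
  have cx: "(x \<times> z) \<bullet> x = 0" "(x \<times> z) \<bullet> z = 0" by (simp_all add: dot_cross_self)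
  show "x \<bullet> common_nbr x \<sigma> z = -1/3"
    using mid(1) cx by (simp add: common_nbr_def inner_add_right inner_commute)
  show "common_nbr x \<sigma> z \<bullet> z = - norm z / 3"
    using mid(2) cx by (simp add: common_nbr_def inner_add_left)
  have "common_nbr x \<sigma> z \<bullet> common_nbr x \<sigma> z = common_nbr_mid x z \<bullet> common_nbr_mid x z
      + \<sigma>\<^sup>2 * ((common_nbr_height x z)\<^sup>2 * ((x \<times> z) \<bullet> (x \<times> z)))"
    using mid(3) by (simp add: common_nbr_def inner_add_left inner_add_right
        inner_commute[of "x \<times> z" "common_nbr_mid x z"] power2_eq_square)
  also have "\<dots> = 1"
    using \<sigma> mid(4)[OF mid(1,2)] common_nbr_height_sq[OF z] by (simp add: inner_cross_self_unit[OF x])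
  finally show "norm (common_nbr x \<sigma> z) = 1" by (simp add: norm_eq_1)
qed

text \<open>
  The explicit form of a common neighbour is wanted for its smooth dependence on \<open>z\<close>: it lets a step
  of the two-generation construction be undone by a differentiable map.
\<close>

lemma common_nbr_unique:
  assumes x: "norm x = 1" and z: "z \<in> common_nbr_dom x"
    and v: "norm v = 1" "x \<bullet> v = -1/3" "v \<bullet> z = - norm z / 3"
  shows "v = common_nbr x 1 z \<or> v = common_nbr x (-1) z"
proof -
  note mid = common_nbr_mid_inner[OF x z]
  define c where "c = x \<times> z"
  define D where "D = (norm z)\<^sup>2 - (x \<bullet> z)\<^sup>2"
  define e where "e = (v \<bullet> c) / D"
  have "D > 0" using common_nbr_domD(3)[OF z] by (simp add: D_def)
  have cc: "c \<bullet> c = D" by (simp add: c_def D_def inner_cross_self_unit[OF x])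
  have cx: "c \<bullet> x = 0" "c \<bullet> z = 0" by (simp_all add: c_def dot_cross_self)
  have vx: "v \<bullet> x = - 1/3" using v by (simp add: inner_commute)
  define w where "w = v - common_nbr_mid x z - e *\<^sub>R c"
  have "w \<bullet> x = 0" "w \<bullet> z = 0"
    using mid v vx cx by (simp_all add: w_def inner_diff_left)
  then have "w \<times> c = 0"
    unfolding c_def Lagrange by simp
  moreover have "w \<bullet> c = 0"
    using \<open>D > 0\<close> mid(3) cc by (simp add: w_def inner_diff_left e_def c_def)
  ultimately have "w = 0"
    using norm_and_cross_eq_0[of w c] cc \<open>D > 0\<close> by auto
  then have veq: "v = common_nbr_mid x z + e *\<^sub>R c" by (simp add: w_def algebra_simps)
  have "1 = v \<bullet> v" using v by (simp add: dot_square_norm)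
  also have "\<dots> = v \<bullet> common_nbr_mid x z + e * (v \<bullet> c)"
    by (subst (2) veq) (simp add: inner_add_right)
  also have "v \<bullet> c = e * D"
    using \<open>D > 0\<close> by (simp add: e_def)
  finally have "e\<^sup>2 * D = (common_nbr_height x z)\<^sup>2 * D"
    using common_nbr_height_sq[OF z] mid(4)[OF vx v(3)] by (simp add: power2_eq_square D_def)
  then have "e = common_nbr_height x z \<or> e = - common_nbr_height x z"
    using \<open>D > 0\<close> by (simp add: power2_eq_iff)
  then show ?thesis
    using veq unfolding common_nbr_def c_def by auto
qed

lemma differentiable_cross3:
  fixes f g :: "'a::real_normed_vector \<Rightarrow> real^3"
  assumes "f differentiable (at x within S)" "g differentiable (at x within S)"
  shows "(\<lambda>x. f x \<times> g x) differentiable (at x within S)"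
proof -
  obtain f' g' where "(f has_derivative f') (at x within S)" "(g has_derivative g') (at x within S)"
    using assms by (auto simp: differentiable_def)
  moreover have "bounded_bilinear (\<times>)"
    using bilinear_cross bilinear_conv_bounded_bilinear by blast
  ultimately show ?thesis
    unfolding differentiable_def using bounded_bilinear.FDERIV by blast
qed

lemma differentiable_common_nbr:
  assumes "z \<in> common_nbr_dom x"
  shows "common_nbr x \<sigma> differentiable (at z)"
proof -
  note pos = common_nbr_domD[OF assms]
  have sq: "(\<lambda>z. sqrt (f z)) differentiable (at z)"
    if f: "f differentiable (at z)" "f z > 0" for f :: "real^3 \<Rightarrow> real"
  proof -
    obtain f' where "(f has_derivative f') (at z)" using f(1) unfolding differentiable_def by blast
    from has_derivative_real_sqrt[OF f(2) this] show ?thesis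
      unfolding differentiable_def by blast
  qed
  have n: "norm differentiable (at z)" using pos by simp
  show ?thesis
    unfolding common_nbr_def[abs_def] common_nbr_mid_def common_nbr_height_def using pos
    by (intro differentiable_add differentiable_scaleR differentiable_minus differentiable_mult
        differentiable_divide differentiable_inner differentiable_const differentiable_ident
        differentiable_cross3 differentiable_power differentiable_diff sq n) auto
qed

section \<open>Tetrahedra avoiding a null set\<close>

lemma funpow_rot3_cube:
  assumes "norm v = 1" "j \<le> 3"
  shows "(rot3 v ^^ (3 - j)) ((rot3 v ^^ j) z) = z"
proof -
  have "(rot3 v ^^ (3 - j)) ((rot3 v ^^ j) z) = (rot3 v ^^ (3 - j + j)) z"
    by (simp only: funpow_add o_apply)
  also have "3 - j + j = 3" using assms(2) by simp
  finally show ?thesis by (simp add: numeral_3_eq_3 rot3_cube assms(1))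
qed

lemma orthogonal_funpow_rot3:
  assumes "norm v = 1" shows "orthogonal_transformation (rot3 v ^^ j)"
proof (induction j)
  case (Suc j)
  then show ?case
    using orthogonal_transformation_compose[OF orthogonal_transformation_rot3[OF assms]] by (simp add: o_def)
qed (simp add: orthogonal_transformation_id id_def)

lemma funpow_rot3_axis:
  assumes "norm v = 1" shows "v \<bullet> (rot3 v ^^ j) z = v \<bullet> z"
  by (induction j) (simp_all add: inner_rot3_axis assms)

lemma differentiable_rot3:
  assumes "f differentiable (at z)" "g differentiable (at z)"
  shows "(\<lambda>z. rot3 (f z) (g z)) differentiable (at z)"
  unfolding rot3_def using assms
  by (intro differentiable_add differentiable_scaleR differentiable_mult
        differentiable_inner differentiable_const differentiable_cross3) auto

lemma differentiable_funpow_rot3: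
  assumes "f differentiable (at z)"
  shows "(\<lambda>z. (rot3 (f z) ^^ j) z) differentiable (at z)"
  by (induction j) (simp_all add: differentiable_rot3 assms)

text \<open>
  A direction \<open>z\<close> whose whole orbit about the common neighbour \<open>v\<close> stays in the domain. It is found
  by placing \<open>z\<close> at a right angle, as seen from \<open>v\<close>, to the plane of \<open>x\<close> and \<open>v\<close>: the orbit then has the
  angles 90, 210 and 330 degrees and misses that plane.
\<close>

lemma exists_generic_position:
  assumes x: "norm x = 1" and r: "r > 0"
  obtains \<sigma> z where "\<sigma> = 1 \<or> \<sigma> = (-1::real)" "norm z < r"
    "\<And>j. j < 3 \<Longrightarrow> (rot3 (common_nbr x \<sigma> z) ^^ j) z \<in> common_nbr_dom x"
proof -
  obtain y where y: "norm y = 1" "x \<bullet> y = 0"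
  proof -
    obtain y0 :: "real^3" where "y0 \<noteq> 0" "orthogonal x y0"
      using orthogonal_to_vector_exists[of x] by auto
    then show thesis
      by (intro that[of "sgn y0"]) (auto simp: norm_sgn sgn_div_norm orthogonal_def)
  qed
  have xx: "x \<bullet> x = 1" "y \<bullet> y = 1" "y \<bullet> x = 0" using x y by (auto simp: dot_square_norm inner_commute)
  define v where "v = - (1/3) *\<^sub>R x + (sqrt 8 / 3) *\<^sub>R y"
  have "v \<bullet> v = 1" "v \<bullet> x = - 1/3"
    using xx y by (simp_all add: v_def inner_add_left inner_add_right inner_diff_left inner_diff_right)
  then have v: "norm v = 1" "x \<bullet> v = - 1/3" "v \<bullet> v = 1" "v \<bullet> x = - 1/3"
    by (simp_all add: norm_eq_1 inner_commute)
  define t where "t = r / 2"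
  have t: "t > 0" using r by (simp add: t_def)
  define b where "b = x \<times> v"
  define z where "z = t *\<^sub>R (- (1/3) *\<^sub>R v + b)"
  have bb: "b \<bullet> b = 8/9" 
    using inner_cross_self_unit[OF x, of v] v by (simp add: b_def power2_eq_square)
  have b0: "b \<bullet> v = 0" "v \<bullet> b = 0" "x \<bullet> b = 0" by (simp_all add: b_def dot_cross_self)
  have "norm (- (1/3) *\<^sub>R v + b) = 1"
    unfolding norm_eq_1 using v bb b0 by (simp add: inner_diff_left inner_diff_right)
  then have nz: "norm z = t" using t unfolding z_def by simp
  have vz: "v \<bullet> z = - norm z / 3"
    unfolding nz using v b0 by (simp add: z_def inner_diff_right)
  have vb: "v \<times> b = x - (v \<bullet> x) *\<^sub>R v"
    unfolding b_def Lagrange using v by simp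
  have vzc: "v \<times> z = t *\<^sub>R (x + (1/3) *\<^sub>R v)"
    using v by (simp add: z_def cross_mult_right cross_add_right vb Cross3.right_diff_distrib)
  have xz: "x \<bullet> z = t / 9" using v b0 by (simp add: z_def inner_diff_right)
  have xvz: "x \<bullet> (v \<times> z) = t * (8/9)" using v x by (simp add: vzc inner_add_right dot_square_norm)
  have s3: "0 < sqrt 3" "sqrt 3 < 7/4"
    by (simp, rule real_less_lsqrt) (simp_all add: power2_eq_square)
  have vz': "v \<bullet> z = - t / 3" using vz nz by simp
  have mem: "(rot3 v ^^ j) z \<in> common_nbr_dom x" if j: "j < 3" for j
  proof -
    have n: "norm ((rot3 v ^^ j) z) = t"
      using orthogonal_transformation_norm[OF orthogonal_funpow_rot3[OF v(1)]] nz by simp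
    have scaled: "-7 * t < 9 * (t * a) \<and> t * a < t" if "-7/9 < a" "a < 1" for a
      using mult_strict_left_mono[OF that(1) t] mult_strict_left_mono[OF that(2) t] by simp
    consider "j = 0" | "j = 1" | "j = 2" using j by linarith
    then show ?thesis
    proof cases
      case 1
      then show ?thesis using t by (simp add: common_nbr_dom_def nz xz)
    next
      case 2
      have "x \<bullet> rot3 v z = t * (1 / 9 + sqrt 3 * (4 / 9))"
        unfolding rot3_def inner_add_right inner_scaleR_right xz xvz vz' v(2) by (simp add: algebra_simps)
      then show ?thesis using scaled[of "1/9 + sqrt 3 * (4/9)"] s3 n by (simp add: common_nbr_dom_def 2)
    next
      case 3
      have "x \<bullet> rot3 v (rot3 v z) = t * (1 / 9 - sqrt 3 * (4 / 9))"
        unfolding rot3_rot3[OF v(1)] inner_add_right inner_diff_right inner_scaleR_right xz xvz vz' v(2)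
        by (simp add: algebra_simps)
      then show ?thesis using scaled[of "1/9 - sqrt 3 * (4/9)"] s3 n
        by (simp add: common_nbr_dom_def 3 numeral_2_eq_2)
    qed
  qed
  have "v = common_nbr x 1 z \<or> v = common_nbr x (-1) z"
    using common_nbr_unique[OF x _ v(1,2) vz] mem[of 0] by simp
  then obtain \<sigma> where \<sigma>: "\<sigma> = 1 \<or> \<sigma> = (-1::real)" "common_nbr x \<sigma> z = v" by blast
  have "norm z < r" using nz r by (simp add: t_def)
  then show thesis
    by (rule that[OF \<sigma>(1)]) (unfold \<sigma>(2), rule mem)
qed

text \<open>
  The nine points of the two-generation construction are functions of \<open>z\<close>, which ranges over an open
  set \<open>U\<close>. Each of them is the image of \<open>z\<close> under a map with differentiable local inverses: given the
  image \<open>y\<close>, the vertex \<open>v\<close> is one of the two common neighbours of \<open>x\<close> and \<open>y\<close>, and rotating about it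
  leads back to \<open>z\<close>. Differentiable maps preserve null sets, so the bad \<open>z\<close> form a null set and
  cannot fill \<open>U\<close>.
\<close>

lemma tetrahedra_avoiding_null_set:
  assumes x: "norm x = 1" and r: "r > 0" and N: "negligible N"
  obtains v z where "norm v = 1" "x \<bullet> v = - 1/3" "z \<noteq> 0" "norm z < r" "v \<bullet> z = - norm z / 3"
    "\<And>i j. i < 3 \<Longrightarrow> j < 3 \<Longrightarrow> (rot3 x ^^ i) ((rot3 v ^^ j) z) \<notin> N"
proof -
  obtain \<sigma> z0 where \<sigma>: "\<sigma> = 1 \<or> \<sigma> = (-1::real)" and z0: "norm z0 < r"
    "\<And>j. j < 3 \<Longrightarrow> (rot3 (common_nbr x \<sigma> z0) ^^ j) z0 \<in> common_nbr_dom x"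
    using exists_generic_position[OF x r] by blast
  have \<sigma>2: "\<sigma>\<^sup>2 = 1" using \<sigma> by auto
  define f where "f \<tau> k y = (rot3 (common_nbr x \<tau> y) ^^ k) y" for \<tau> k y
  have diff_f: "f \<tau> k differentiable (at y)" if "y \<in> common_nbr_dom x" for \<tau> k y
    unfolding f_def by (intro differentiable_funpow_rot3 differentiable_common_nbr that)
  define U where "U = (\<Inter>j<3. {z \<in> common_nbr_dom x \<inter> ball 0 r. f \<sigma> j z \<in> common_nbr_dom x})"
  have "open U"
    unfolding U_def
  proof (intro open_INT ballI)
    fix j
    have "continuous_on (common_nbr_dom x \<inter> ball 0 r) (f \<sigma> j)"
      using diff_f by (intro continuous_at_imp_continuous_on) (auto intro: differentiable_imp_continuous_within)
    then have "open ((common_nbr_dom x \<inter> ball 0 r) \<inter> f \<sigma> j -` common_nbr_dom x)"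
      by (rule continuous_open_preimage) (intro open_Int open_common_nbr_dom open_ball)+
    also have "(common_nbr_dom x \<inter> ball 0 r) \<inter> f \<sigma> j -` common_nbr_dom x =
        {z \<in> common_nbr_dom x \<inter> ball 0 r. f \<sigma> j z \<in> common_nbr_dom x}"
      by auto
    finally show "open {z \<in> common_nbr_dom x \<inter> ball 0 r. f \<sigma> j z \<in> common_nbr_dom x}" .
  qed auto
  moreover have "z0 \<in> U"
    using z0 z0(2)[of 0] by (auto simp: U_def f_def)
  ultimately have U: "\<not> negligible U" using open_not_negligible by blast
  \<comment> \<open>Closing \<open>N\<close> under the rotations about \<open>x\<close> removes the outer rotation from consideration.\<close>
  define N' where "N' = (\<Union>i\<in>{..3}. (rot3 x ^^ i) ` N)"
  have "negligible N'"
    unfolding N'_def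
  proof (intro negligible_Union finite_imageI finite_atMost, clarify)
    fix i show "negligible ((rot3 x ^^ i) ` N)"
      using orthogonal_funpow_rot3[OF x] N
      by (intro negligible_differentiable_image_negligible)
         (auto simp: orthogonal_transformation_def linear_imp_differentiable_on)
  qed
  then have "negligible (N' \<inter> common_nbr_dom x)" by (rule negligible_subset) auto
  then have "negligible (\<Union>\<tau>\<in>{1,-1}. \<Union>k\<in>{..3}. f \<tau> k ` (N' \<inter> common_nbr_dom x))"
    by (auto simp: differentiable_on_def intro!: negligible_Union
        negligible_differentiable_image_negligible differentiable_at_withinI diff_f)
  then have "\<not> U \<subseteq> (\<Union>\<tau>\<in>{1,-1}. \<Union>k\<in>{..3}. f \<tau> k ` (N' \<inter> common_nbr_dom x))"
    using U negligible_subset by blast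
  then obtain z where z: "z \<in> U" and zn: "z \<notin> (\<Union>\<tau>\<in>{1,-1}. \<Union>k\<in>{..3}. f \<tau> k ` (N' \<inter> common_nbr_dom x))"
    unfolding subset_iff by metis
  have zU: "z \<in> common_nbr_dom x \<and> norm z < r \<and> f \<sigma> j z \<in> common_nbr_dom x" if "j < 3" for j
    using z that by (auto simp: U_def)
  then have zd: "z \<in> common_nbr_dom x" "norm z < r" "\<And>j. j < 3 \<Longrightarrow> f \<sigma> j z \<in> common_nbr_dom x"
    using zU[of 0] by auto
  define v where "v = common_nbr x \<sigma> z"
  note v = common_nbr_adjacent[OF x zd(1) \<sigma>2, folded v_def]
  show thesis
  proof (rule that[of v z])
    show "z \<noteq> 0" using common_nbr_domD(1)[OF zd(1)] .
    fix i j :: nat assume ij: "i < 3" "j < 3"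
    show "(rot3 x ^^ i) ((rot3 v ^^ j) z) \<notin> N"
    proof
      assume bad: "(rot3 x ^^ i) ((rot3 v ^^ j) z) \<in> N"
      define y where "y = (rot3 v ^^ j) z"
      have y: "y \<in> common_nbr_dom x" using zd(3)[OF ij(2)] by (simp add: y_def f_def v_def)
      have "y = (rot3 x ^^ (3 - i)) ((rot3 x ^^ i) y)"
        using funpow_rot3_cube[OF x] ij by simp
      then have "y \<in> (rot3 x ^^ (3 - i)) ` N"
        using bad unfolding y_def by (rule image_eqI)
      then have "y \<in> N'" unfolding N'_def by (intro UN_I[of "3 - i"]) auto
      have "norm y = norm z"
        unfolding y_def by (rule orthogonal_transformation_norm[OF orthogonal_funpow_rot3[OF v(1)]])
      then have "v \<bullet> y = - norm y / 3" using v(3) by (simp add: y_def funpow_rot3_axis[OF v(1)])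
      then obtain \<tau> where \<tau>: "\<tau> \<in> {1,-1}" "v = common_nbr x \<tau> y"
        using common_nbr_unique[OF x y v(1,2)] by blast
      have "z = f \<tau> (3 - j) y"
        unfolding f_def \<tau>(2)[symmetric] unfolding y_def using funpow_rot3_cube[OF v(1)] ij by simp
      then have "z \<in> f \<tau> (3 - j) ` (N' \<inter> common_nbr_dom x)"
        using \<open>y \<in> N'\<close> y by (intro image_eqI[of _ _ y] IntI)
      then have "z \<in> (\<Union>k\<in>{..3}. f \<tau> k ` (N' \<inter> common_nbr_dom x))"
        by (intro UN_I[of "3 - j"]) auto
      then have "z \<in> (\<Union>\<tau>\<in>{1,-1}. \<Union>k\<in>{..3}. f \<tau> k ` (N' \<inter> common_nbr_dom x))"
        by (rule UN_I[OF \<tau>(1)])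
      then show False using zn by contradiction
    qed
  qed (fact v zd)+
qed

section \<open>Isometries close to the identity\<close>

definition reflect :: "real^3 \<Rightarrow> real^3 \<Rightarrow> real^3" where
  "reflect a y = y - (2 * (a \<bullet> y)) *\<^sub>R a"

lemma orthogonal_transformation_reflect:
  assumes "norm a = 1" shows "orthogonal_transformation (reflect a)"
proof -
  have "linear (reflect a)"
    by (rule linearI) (simp_all add: reflect_def inner_add_right vec_eq_iff algebra_simps)
  then show ?thesis using assms
    by (simp add: orthogonal_transformation_def reflect_def inner_diff_left inner_diff_right
        dot_square_norm inner_commute algebra_simps)
qed

text \<open>
  Compose the reflection in the plane orthogonal to \<open>x\<close>, which sends \<open>x\<close> to \<open>- x\<close>, with the one in the
  plane orthogonal to the bisector \<open>a\<close> of \<open>x\<close> and \<open>x'\<close>, which sends \<open>- x\<close> to \<open>x'\<close>. The mirrors nearly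
  coincide when \<open>x\<close> and \<open>x'\<close> are close.
\<close>

lemma orthogonal_transformation_near_id:
  fixes x x' :: "real^3"
  assumes x: "norm x = 1" and x': "norm x' = 1" and ne: "x' \<noteq> - x"
  obtains h where "orthogonal_transformation h" "h x = x'"
    "\<And>y. norm (h y - y) \<le> 4 * norm (x - x') * norm y"
proof -
  define u where "u = x + x'"
  define a where "a = sgn u"
  define m where "m = a \<bullet> x"
  have u0: "u \<noteq> 0" using ne by (auto simp: u_def eq_neg_iff_add_eq_0 add.commute)
  then have na: "norm a = 1" by (simp add: a_def norm_sgn)
  have xx: "x \<bullet> x = 1" "x' \<bullet> x' = 1" "a \<bullet> a = 1" using x x' na by (auto simp: dot_square_norm)
  have uu: "u \<bullet> u = 2 * (u \<bullet> x)" using xx by (simp add: u_def inner_add_left inner_add_right inner_commute)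
  have ua: "u = norm u *\<^sub>R a" using u0 by (simp add: a_def sgn_div_norm)
  have "norm u * norm u = 2 * (norm u * m)"
    using uu by (subst (asm) (3) ua) (simp add: dot_square_norm power2_eq_square m_def)
  then have nu: "norm u = 2 * m" using u0 by simp
  have x'_eq: "x' = (2 * m) *\<^sub>R a - x" using ua unfolding nu by (simp add: u_def algebra_simps)
  define h where "h = reflect a \<circ> reflect x"
  have "orthogonal_transformation h"
    unfolding h_def by (intro orthogonal_transformation_compose orthogonal_transformation_reflect na x)
  moreover have "h x = x'"
  proof -
    have "reflect x x = - x" using xx by (simp add: reflect_def scaleR_2)
    then show ?thesis by (simp add: h_def x'_eq m_def) (simp add: reflect_def)
  qed
  moreover have "norm (h y - y) \<le> 4 * norm (x - x') * norm y" for y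
  proof -
    have m1: "0 \<le> m" "m \<le> 1" using nu norm_ge_zero[of u] norm_cauchy_schwarz[of a x] na x by (auto simp: m_def)
    have p: "x \<bullet> x' = 2 * m\<^sup>2 - 1" using xx by (simp add: x'_eq m_def inner_diff_right power2_eq_square inner_commute)
    have "m * m \<le> m * 1" using m1 by (intro mult_left_mono) auto
    then have "x \<bullet> x' \<le> x \<bullet> a" using m1 unfolding p m_def[symmetric] power2_eq_square inner_commute[of x a] by simp
    then have "(norm (x - a))\<^sup>2 \<le> (norm (x - x'))\<^sup>2"
      using xx by (simp add: power2_norm_eq_inner inner_diff_left inner_diff_right inner_commute)
    then have le: "norm (x - a) \<le> norm (x - x')" by (rule power2_le_imp_le) simp
    define w where "w = reflect x y"
    have nw: "norm w = norm y"
      unfolding w_def by (rule orthogonal_transformation_norm[OF orthogonal_transformation_reflect[OF x]])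
    have y: "y = reflect x w" using xx by (simp add: w_def reflect_def inner_diff_right)
    have "h y - y = reflect a w - reflect x w" using y by (simp add: h_def w_def)
    also have "\<dots> = (2 * ((x - a) \<bullet> w)) *\<^sub>R x + (2 * (a \<bullet> w)) *\<^sub>R (x - a)"
      by (simp add: reflect_def inner_diff_left algebra_simps)
    also have "norm \<dots> \<le> 2 * \<bar>(x - a) \<bullet> w\<bar> * norm x + 2 * \<bar>a \<bullet> w\<bar> * norm (x - a)"
      by (rule order.trans[OF norm_triangle_ineq]) (simp add: abs_mult)
    also have "\<dots> \<le> 2 * (norm (x - a) * norm w) + 2 * norm w * norm (x - a)"
      using Cauchy_Schwarz_ineq2[of "x - a" w] Cauchy_Schwarz_ineq2[of a w] x na
      by (intro add_mono mult_right_mono) auto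
    also have "\<dots> = 4 * norm (x - a) * norm y" by (simp add: nw)
    also have "\<dots> \<le> 4 * norm (x - x') * norm y" using le by (intro mult_right_mono) auto
    finally show ?thesis .
  qed
  ultimately show thesis by (rule that)
qed

section \<open>Almost invariance of measurable colorings\<close>

text \<open>
  The color classes are exhausted up to small measure by compact sets, and finitely many disjoint
  compact sets have positive distance from each other.
\<close>

lemma finite_coloring_uniform_off_small_set:
  fixes c :: "'a::euclidean_space \<Rightarrow> 'b"
  assumes B: "bounded B" and K: "finite K" "c ` B \<subseteq> K"
    and meas: "\<And>i. i \<in> K \<Longrightarrow> {y \<in> B. c y = i} \<in> sets lebesgue" and e: "e > 0"
  obtains E d where "E \<in> lmeasurable" "measure lebesgue E \<le> e" "d > 0"
    "\<And>y y'. y \<in> B - E \<Longrightarrow> y' \<in> B - E \<Longrightarrow> dist y y' < d \<Longrightarrow> c y = c y'"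
proof -
  define A where "A i = {y \<in> B. c y = i}" for i
  define e' where "e' = e / (real (card K) + 1)"
  have e': "e' > 0" using e by (simp add: e'_def)
  have "\<exists>T. closed T \<and> T \<subseteq> A i \<and> A i - T \<in> lmeasurable \<and> measure lebesgue (A i - T) \<le> e'" if "i \<in> K" for i
  proof -
    have "A i \<in> sets lebesgue" using meas[OF that] by (simp add: A_def)
    from sets_lebesgue_inner_closed[OF this e']
    obtain T where "closed T" "T \<subseteq> A i" "A i - T \<in> lmeasurable" "emeasure lebesgue (A i - T) < ennreal e'" .
    then show ?thesis using e' by (metis measure_def enn2real_leI less_imp_le)
  qed
  then obtain T where T: "\<And>i. i \<in> K \<Longrightarrow> closed (T i)" "\<And>i. i \<in> K \<Longrightarrow> T i \<subseteq> A i"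
    "\<And>i. i \<in> K \<Longrightarrow> A i - T i \<in> lmeasurable" "\<And>i. i \<in> K \<Longrightarrow> measure lebesgue (A i - T i) \<le> e'"
    by metis
  define E where "E = (\<Union>i\<in>K. A i - T i)"
  have "E \<in> lmeasurable" unfolding E_def using K T by (intro fmeasurable.finite_UN) auto
  have "measure lebesgue E \<le> (\<Sum>i\<in>K. measure lebesgue (A i - T i))"
    unfolding E_def using K T by (intro measure_UNION_le) auto
  also have "\<dots> \<le> real (card K) * e'" using T(4) by (rule sum_bounded_above)
  also have "\<dots> \<le> e" using e by (simp add: e'_def field_simps)
  finally have "measure lebesgue E \<le> e" .
  have sep: "\<exists>d>0. \<forall>y\<in>T i. \<forall>y'\<in>T j. d \<le> dist y y'" if "i \<in> K" "j \<in> K" "i \<noteq> j" for i j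
  proof (rule separate_compact_closed)
    have "bounded (T i)" by (rule bounded_subset[OF B]) (use T(2)[OF that(1)] in \<open>auto simp: A_def\<close>)
    then show "compact (T i)" using T(1)[OF that(1)] by (simp add: compact_eq_bounded_closed)
    show "closed (T j)" using T that by simp
    show "T i \<inter> T j = {}" using T(2)[OF that(1)] T(2)[OF that(2)] that(3) by (auto simp: A_def)
  qed
  define P where "P = Sigma K (\<lambda>i. K - {i})"
  have "\<forall>p\<in>P. \<exists>d>0. \<forall>y\<in>T (fst p). \<forall>y'\<in>T (snd p). d \<le> dist y y'"
    using sep by (auto simp: P_def)
  then obtain D where D: "\<And>p. p \<in> P \<Longrightarrow> D p > (0::real)"
    "\<And>p y y'. p \<in> P \<Longrightarrow> y \<in> T (fst p) \<Longrightarrow> y' \<in> T (snd p) \<Longrightarrow> D p \<le> dist y y'"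
    by metis
  have finP: "finite P" using K by (simp add: P_def)
  define d where "d = Min (insert 1 (D ` P))"
  have "d > 0" using finP D(1) by (simp add: d_def)
  have "c y = c y'" if y: "y \<in> B - E" "y' \<in> B - E" "dist y y' < d" for y y'
  proof (rule ccontr)
    assume "c y \<noteq> c y'"
    then have p: "(c y, c y') \<in> P" using y K by (auto simp: P_def)
    have "y \<in> T (c y)" "y' \<in> T (c y')" using y K by (auto simp: E_def A_def)
    then have "D (c y, c y') \<le> dist y y'" using D(2)[OF p] by simp
    moreover have "d \<le> D (c y, c y')" using finP p by (simp add: d_def)
    ultimately show False using y(3) by simp
  qed
  then show thesis using that \<open>E \<in> lmeasurable\<close> \<open>measure lebesgue E \<le> e\<close> \<open>d > 0\<close> by blast
qed

section \<open>Four colors on tetrahedra\<close>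

lemma distinct_colors_sum:
  fixes a b p q :: nat
  assumes "a \<in> {1..4}" "b \<in> {1..4}" "p \<in> {1..4}" "q \<in> {1..4}" "distinct [a, b, p, q]"
  shows "a + b + p + q = 10"
proof -
  have "{a, b, p, q} = {1..4}"
    using assms by (intro card_subset_eq) auto
  then have "\<Sum>{a, b, p, q} = \<Sum>{1..4::nat}" by simp
  moreover have "\<Sum>{1..4::nat} = 10" by (simp add: numeral_eq_Suc)
  ultimately show ?thesis using assms(5) by simp
qed

text \<open>
  The color sum is a convenient way to say that three vertices determine the color of the fourth. The
  isometry \<open>h\<close> allows the same tetrahedron to be compared with its displaced copy.
\<close>

lemma tetrahedron_color_sum:
  fixes c :: "real^3 \<Rightarrow> nat"
  assumes range: "\<And>y. y \<noteq> 0 \<Longrightarrow> c y \<in> {1..4}"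
    and proper: "\<And>u v. u \<noteq> 0 \<Longrightarrow> v \<noteq> 0 \<Longrightarrow> u \<bullet> v = - (norm u * norm v) / 3 \<Longrightarrow> c u \<noteq> c v"
    and h: "orthogonal_transformation h"
    and v: "norm v = 1" and z: "z \<noteq> 0" "v \<bullet> z = - norm z / 3"
  shows "c (h v) + (\<Sum>j<3. c (h ((rot3 v ^^ j) z))) = 10"
proof -
  define z1 z2 where "z1 = rot3 v z" and "z2 = rot3 v (rot3 v z)"
  note rot = orthogonal_transformation_rot3[OF v]
  have n: "norm z1 = norm z" "norm z2 = norm z"
    using orthogonal_transformation_norm[OF rot] by (simp_all add: z1_def z2_def)
  have "z \<bullet> z1 = - (norm z * norm z) / 3"
    by (simp add: z1_def inner_self_rot3 z power2_eq_square)
  moreover have "z1 \<bullet> z2 = z \<bullet> z1"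
    using inner_rot3[OF v] by (simp add: z1_def z2_def)
  moreover have "z2 \<bullet> z = z1 \<bullet> z2"
    using inner_rot3[OF v, of z2 z1] inner_rot3[OF v, of z2 z] rot3_cube[OF v, of z]
    by (simp add: z1_def z2_def inner_commute inner_rot3[OF v])
  ultimately have zs: "z \<bullet> z1 = - (norm z * norm z) / 3" "z1 \<bullet> z2 = - (norm z * norm z) / 3"
    "z \<bullet> z2 = - (norm z * norm z) / 3"
    by (simp_all add: inner_commute)
  have vs: "v \<bullet> z1 = - norm z / 3" "v \<bullet> z2 = - norm z / 3"
    using z by (simp_all add: z1_def z2_def inner_rot3_axis[OF v])
  have hn: "norm (h p) = norm p" for p by (rule orthogonal_transformation_norm[OF h])
  have h0: "h p \<noteq> 0" if "norm p > 0" for p using that hn[of p] by auto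
  have hp: "c (h p) \<noteq> c (h q)" if "norm p > 0" "norm q > 0" "p \<bullet> q = - (norm p * norm q) / 3" for p q
    using h that(3) by (intro proper h0 that) (simp add: orthogonal_transformation_def hn)
  have pos: "norm v > 0" "norm z > 0" "norm z1 > 0" "norm z2 > 0" using v z n by auto
  have "c (h v) + c (h z) + c (h z1) + c (h z2) = 10"
  proof (rule distinct_colors_sum)
    show "distinct [c (h v), c (h z), c (h z1), c (h z2)]"
      using hp[OF pos(1,2)] hp[OF pos(1,3)] hp[OF pos(1,4)] hp[OF pos(2,3)] hp[OF pos(2,4)] hp[OF pos(3,4)]
        v z vs zs n by simp
  qed (intro range h0 pos)+
  then show ?thesis by (simp add: numeral_3_eq_3 z1_def z2_def)
qed

lemma color_sum_two_generations:
  fixes c :: "real^3 \<Rightarrow> nat"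
  assumes range: "\<And>y. y \<noteq> 0 \<Longrightarrow> c y \<in> {1..4}"
    and proper: "\<And>u v. u \<noteq> 0 \<Longrightarrow> v \<noteq> 0 \<Longrightarrow> u \<bullet> v = - (norm u * norm v) / 3 \<Longrightarrow> c u \<noteq> c v"
    and h: "orthogonal_transformation h"
    and x: "norm x = 1" and v: "norm v = 1" "x \<bullet> v = - 1/3" and z: "z \<noteq> 0" "v \<bullet> z = - norm z / 3"
  shows "c (h x) + 20 = (\<Sum>i<3. \<Sum>j<3. c (h ((rot3 x ^^ i) ((rot3 v ^^ j) z))))"
proof -
  let ?S = "\<lambda>i. \<Sum>j<3. c (h ((rot3 x ^^ i) ((rot3 v ^^ j) z)))"
  have "v \<noteq> 0" using v by auto
  then have 1: "c (h x) + (\<Sum>i<3. c (h ((rot3 x ^^ i) v))) = 10"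
    using v by (intro tetrahedron_color_sum[OF range proper h x]) auto
  have "c (h ((rot3 x ^^ i) v)) + ?S i = 10" for i
    using tetrahedron_color_sum[OF range proper
        orthogonal_transformation_compose[OF h orthogonal_funpow_rot3[OF x]] v(1) z] by simp
  then have "(\<Sum>i<3. c (h ((rot3 x ^^ i) v)) + ?S i) = (\<Sum>i<3::nat. 10)" by (intro sum.cong) auto
  then have "(\<Sum>i<3. c (h ((rot3 x ^^ i) v))) + (\<Sum>i<3. ?S i) = 30"
    by (simp add: sum.distrib)
  then show ?thesis using 1 by linarith
qed

text \<open>
  If the colors near \<open>x\<close> varied, isometries \<open>h n\<close> converging fast to the identity would change the color
  of \<open>x\<close> and yet eventually preserve that of each point of the ball outside a null set; but the nine points
  determining the color of \<open>x\<close> can avoid that null set. They are taken with small norm, inside the ball in which \<open>c\<close> is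
  known to be measurable.
\<close>

lemma color_locally_constant:
  fixes c :: "real^3 \<Rightarrow> nat"
  assumes r: "r > 0"
    and range: "\<And>y. y \<noteq> 0 \<Longrightarrow> c y \<in> {1..4}"
    and proper: "\<And>u v. u \<noteq> 0 \<Longrightarrow> v \<noteq> 0 \<Longrightarrow> u \<bullet> v = - (norm u * norm v) / 3 \<Longrightarrow> c u \<noteq> c v"
    and meas: "\<And>i. {y \<in> cball 0 r - {0}. c y = i} \<in> sets lebesgue"
    and x: "norm x = 1"
  shows "\<exists>\<eta>>0. \<forall>x'. norm x' = 1 \<longrightarrow> norm (x - x') < \<eta> \<longrightarrow> c x' = c x"
proof (rule ccontr)
  assume neg: "\<not> ?thesis"
  define B where "B = cball (0::real^3) r - {0}"
  have inB: "p \<in> B \<longleftrightarrow> 0 < norm p \<and> norm p \<le> r" for p by (auto simp: B_def)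
  define Q where "Q n E h \<longleftrightarrow> E \<in> lmeasurable \<and> measure lebesgue E \<le> (1/2) ^ n \<and>
      orthogonal_transformation h \<and> c (h x) \<noteq> c x \<and>
      (\<forall>y. y \<in> B \<longrightarrow> y \<notin> E \<longrightarrow> h y \<notin> E \<longrightarrow> c (h y) = c y)" for n :: nat and E h
  have "\<exists>E h. Q n E h" for n
  proof -
    have bB: "bounded B" unfolding B_def by (rule bounded_diff) simp
    have cB: "c ` B \<subseteq> {1..4}"
    proof
      fix i assume "i \<in> c ` B"
      then show "i \<in> {1..4}" using range unfolding B_def by blast
    qed
    have mB: "{y \<in> B. c y = i} \<in> sets lebesgue" for i using meas[of i] unfolding B_def .
    have pos: "(1/2::real) ^ n > 0" by simp
    obtain E d where E: "E \<in> lmeasurable" "measure lebesgue E \<le> (1/2) ^ n" "d > 0"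
      "\<And>y y'. y \<in> B - E \<Longrightarrow> y' \<in> B - E \<Longrightarrow> dist y y' < d \<Longrightarrow> c y = c y'"
      by (rule finite_coloring_uniform_off_small_set[OF bB finite_atLeastAtMost cB mB pos]) (rule that)
    \<comment> \<open>The bound 1 keeps \<open>x'\<close> away from \<open>- x\<close>; the other one makes \<open>h\<close> move the ball by less than \<open>d\<close>.\<close>
    define \<eta> where "\<eta> = min 1 (d / (4 * r))"
    have "\<eta> > 0" using r E(3) by (simp add: \<eta>_def)
    then obtain x' where x': "norm x' = 1" "norm (x - x') < \<eta>" "c x' \<noteq> c x" using neg by blast
    have "x' \<noteq> - x" 
    proof
      assume "x' = - x"
      then have "norm (x - x') = 2" using x by (simp flip: scaleR_2)
      then show False using x'(2) by (simp add: \<eta>_def)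
    qed
    then obtain h where h: "orthogonal_transformation h" "h x = x'"
      "\<And>y. norm (h y - y) \<le> 4 * norm (x - x') * norm y"
      using orthogonal_transformation_near_id[OF x x'(1)] by blast
    have "c (h y) = c y" if y: "y \<in> B" "y \<notin> E" "h y \<notin> E" for y
    proof (rule E(4))
      have "norm (h y) = norm y" by (rule orthogonal_transformation_norm[OF h(1)])
      then have "h y \<in> B" using y(1) unfolding inB by simp
      then show "h y \<in> B - E" "y \<in> B - E" using y by auto
      have "4 * norm (x - x') * norm y \<le> 4 * norm (x - x') * r"
        using y by (intro mult_left_mono) (auto simp: B_def)
      also have "\<dots> < 4 * (d / (4 * r)) * r"
        using x'(2) r by (intro mult_strict_right_mono) (auto simp: \<eta>_def)
      also have "\<dots> = d" using r by simp
      finally show "dist (h y) y < d" using h(3)[of y] by (simp add: dist_norm)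
    qed
    then have "Q n E h" using E(1,2) h(1,2) x'(3) by (simp add: Q_def)
    then show ?thesis by blast
  qed
  then obtain E h where "\<And>n. Q n (E n) (h n)" by metis
  then have E: "\<And>n. E n \<in> lmeasurable" "\<And>n. measure lebesgue (E n) \<le> (1/2) ^ n"
    and h: "\<And>n. orthogonal_transformation (h n)" "\<And>n. c (h n x) \<noteq> c x"
    and keep: "\<And>n y. y \<in> B \<Longrightarrow> y \<notin> E n \<Longrightarrow> h n y \<notin> E n \<Longrightarrow> c (h n y) = c y"
    by (simp_all add: Q_def)
  have limsup_null: "limsup F \<in> null_sets lebesgue"
    if F: "\<And>n. F n \<in> lmeasurable" "\<And>n. measure lebesgue (F n) \<le> (1/2) ^ n" for F :: "nat \<Rightarrow> (real^3) set"
  proof (rule borel_cantelli_limsup1)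
    show "F n \<in> sets lebesgue" "emeasure lebesgue (F n) < \<infinity>" for n
      using F(1)[of n] by (auto simp: fmeasurable_def)
    show "summable (\<lambda>n. measure lebesgue (F n))"
      by (rule summable_comparison_test'[OF summable_geometric[of "1/2"], of 0]) (use F in auto)
  qed
  \<comment> \<open>\<open>F n\<close> collects the points that \<open>h n\<close> moves into the exceptional set.\<close>
  define F where "F n = inv (h n) ` E n" for n
  have hi: "orthogonal_transformation (inv (h n))" for n using h(1) by (rule orthogonal_transformation_inv)
  have F: "F n \<in> lmeasurable" "measure lebesgue (F n) \<le> (1/2) ^ n" for n
    unfolding F_def using measurable_orthogonal_image[OF hi E(1)] measure_orthogonal_image[OF hi E(1)] E(2)
    by simp_all
  define N where "N = limsup E \<union> limsup F"
  have "negligible N"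
    unfolding N_def negligible_iff_null_sets by (intro null_sets.Un limsup_null E F)
  then obtain v z where v: "norm v = 1" "x \<bullet> v = - 1/3" and z: "z \<noteq> 0" "norm z < r" "v \<bullet> z = - norm z / 3"
    and avoid: "\<And>i j. i < 3 \<Longrightarrow> j < 3 \<Longrightarrow> (rot3 x ^^ i) ((rot3 v ^^ j) z) \<notin> N"
    by (rule tetrahedra_avoiding_null_set[OF x r]) (rule that)
  let ?w = "\<lambda>i j. (rot3 x ^^ i) ((rot3 v ^^ j) z)"
  have ev: "\<forall>\<^sub>F n in sequentially. c (h n (?w i j)) = c (?w i j)" if ij: "i < 3" "j < 3" for i j
  proof -
    let ?p = "?w i j"
    have "norm ?p = norm z"
      by (simp add: orthogonal_transformation_norm[OF orthogonal_funpow_rot3[OF x]]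
        orthogonal_transformation_norm[OF orthogonal_funpow_rot3[OF v(1)]])
    then have B: "?p \<in> B" using z unfolding inB by simp
    have "\<forall>\<^sub>F n in sequentially. ?p \<notin> E n" "\<forall>\<^sub>F n in sequentially. ?p \<notin> F n"
      using avoid[OF ij] by (auto simp: N_def limsup_INF_SUP eventually_sequentially)
    then show ?thesis
    proof eventually_elim
      case (elim n)
      have "h n ?p \<notin> E n"
      proof
        assume "h n ?p \<in> E n"
        then have "inv (h n) (h n ?p) \<in> F n" unfolding F_def by (rule imageI)
        then show False using elim(2) orthogonal_transformation_inj[OF h(1)] by (simp add: inv_f_f)
      qed
      then show ?case by (intro keep B elim)
    qed
  qed
  have "\<forall>\<^sub>F n in sequentially. \<forall>i\<in>{..<3}. \<forall>j\<in>{..<3}. c (h n (?w i j)) = c (?w i j)"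
    using ev by (simp add: eventually_ball_finite_distrib)
  then obtain n where n: "\<And>i j. i < 3 \<Longrightarrow> j < 3 \<Longrightarrow> c (h n (?w i j)) = c (?w i j)"
    by (auto simp: eventually_sequentially)
  have "c (h n x) + 20 = (\<Sum>i<3. \<Sum>j<3. c (?w i j))"
    using color_sum_two_generations[where c = c and h = "h n", OF range proper h(1) x v z(1,3)] n by simp
  also have "\<dots> = c x + 20"
    using color_sum_two_generations[where c = c and h = "\<lambda>y. y", OF range proper orthogonal_transformation_id x v z(1,3)] by simp
  finally show False using h(2)[of n] by simp
qed

lemma no_measurable_tetrahedral_coloring:
  fixes c :: "real^3 \<Rightarrow> nat"
  assumes r: "r > 0"
    and range: "\<And>y. y \<noteq> 0 \<Longrightarrow> c y \<in> {1..4}"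
    and proper: "\<And>u v. u \<noteq> 0 \<Longrightarrow> v \<noteq> 0 \<Longrightarrow> u \<bullet> v = - (norm u * norm v) / 3 \<Longrightarrow> c u \<noteq> c v"
    and meas: "\<And>i. {y \<in> cball 0 r - {0}. c y = i} \<in> sets lebesgue"
  shows False
proof -
  have "c constant_on sphere 0 1"
  proof (rule locally_constant_imp_constant)
    show "connected (sphere (0::real^3) 1)" by (rule connected_sphere) simp
    fix x :: "real^3" assume "x \<in> sphere 0 1"
    then have x: "norm x = 1" by simp
    from color_locally_constant[OF assms x]
    obtain \<eta> where \<eta>: "\<eta> > 0" "\<And>x'. norm x' = 1 \<Longrightarrow> norm (x - x') < \<eta> \<Longrightarrow> c x' = c x" by blast
    show "\<exists>T. openin (top_of_set (sphere 0 1)) T \<and> x \<in> T \<and> (\<forall>x'\<in>T. c x' = c x)"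
    proof (intro exI conjI ballI)
      show "openin (top_of_set (sphere 0 1)) (sphere 0 1 \<inter> ball x \<eta>)" by (intro openin_open_Int open_ball)
      show "x \<in> sphere 0 1 \<inter> ball x \<eta>" using x \<eta>(1) by simp
      show "c x' = c x" if "x' \<in> sphere 0 1 \<inter> ball x \<eta>" for x'
        using that by (intro \<eta>(2)) (simp_all add: dist_norm)
    qed
  qed
  moreover define x :: "real^3" where "x = axis 1 1"
  then have x: "norm x = 1" by simp
  obtain v where v: "norm v = 1" "x \<bullet> v = - 1/3"
    by (rule tetrahedra_avoiding_null_set[OF x r negligible_empty]) (rule that)
  ultimately have "c x = c v" using x by (auto simp: constant_on_def)
  moreover have "c x \<noteq> c v" using x v by (intro proper) auto
  ultimately show False by contradiction
qed

section \<open>From the sphere to the ball\<close>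

text \<open>
  Borel sets and null sets of the sphere pull back to such sets of the ball because the surface measure
  is, up to a factor, the image of Lebesgue measure under radial projection.
\<close>

lemma sphere_measurable_cone:
  assumes r: "r > 0" and A: "A \<in> sets (sphere_measure r)"
  shows "{y \<in> cball 0 r - {0}. (r / norm y) *\<^sub>R y \<in> A} \<in> sets lebesgue"
proof -
  let ?M = "restrict_space lborel (cball (0::real^3) r - {0})"
  let ?p = "\<lambda>y::real^3. (r / norm y) *\<^sub>R y"
  have sp: "space ?M = cball 0 r - {0}" by (simp add: space_restrict_space)
  have ball: "cball (0::real^3) r - {0} \<in> sets lborel" by simp
  from A obtain S N N' where A: "A = S \<union> N" "N \<subseteq> N'" "N' \<in> null_sets (sphere_borel_measure r)"
      "S \<in> sets (sphere_borel_measure r)"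
    unfolding sphere_measure_def by (rule sets_completionE)
  let ?R = "restrict_space borel (sphere (0::real^3) r)"
  have pre: "?p -` X \<inter> space ?M \<in> sets lborel" if "X \<in> sets (sphere_borel_measure r)" for X
  proof -
    have "?p -` X \<inter> space ?M \<in> sets ?M"
      using measurable_sets[OF radial_projection_measurable[OF r], of X] that by (simp add: sphere_borel_measure_def)
    then show ?thesis using sets_restrict_space_iff[of "cball (0::real^3) r - {0}" lborel] ball by auto
  qed
  have N': "N' \<in> sets ?R" using A(3) by (auto simp: null_sets_def sphere_borel_measure_def)
  have "ennreal (3 / r) * emeasure (distr ?M ?R ?p) N' = 0"
    using A(3) by (auto simp: null_sets_def sphere_borel_measure_def)
  then have "emeasure (distr ?M ?R ?p) N' = 0" using r by auto
  then have "emeasure ?M (?p -` N' \<inter> space ?M) = 0"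
    by (simp add: emeasure_distr[OF radial_projection_measurable[OF r] N'])
  then have "emeasure lborel (?p -` N' \<inter> space ?M) = 0"
    by (subst (asm) emeasure_restrict_space) (auto simp: sp)
  then have null: "?p -` N' \<inter> space ?M \<in> null_sets lborel"
    using pre A(3) by (auto simp: null_sets_def)
  have "?p -` A \<inter> space ?M \<in> sets lebesgue"
    by (rule sets_completionI[OF _ _ null pre[OF A(4)], of _ "?p -` N \<inter> space ?M"]) (use A in auto)
  moreover have "?p -` A \<inter> space ?M = {y \<in> cball 0 r - {0}. ?p y \<in> A}"
    unfolding sp by auto
  ultimately show ?thesis by simp
qed

lemma measurable_coloring_tetrahedral_radius:
  assumes "measurable_coloring (sqrt (3/8)) k \<phi>"
  shows "k \<ge> 5"
proof (rule ccontr)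
  assume "\<not> k \<ge> 5"
  then have k: "k \<le> 4" by simp
  define r where "r = sqrt (3/8)"
  have r: "r > 0" "r\<^sup>2 = 3/8" by (simp_all add: r_def)
  define p where "p y = (r / norm y) *\<^sub>R y" for y :: "real^3"
  have col: "\<phi> \<in> sphere 0 r \<rightarrow> {1..k}"
    "\<And>u v. u \<in> sphere 0 r \<Longrightarrow> v \<in> sphere 0 r \<Longrightarrow> dist u v = 1 \<Longrightarrow> \<phi> u \<noteq> \<phi> v"
    "\<And>i. i \<in> {1..k} \<Longrightarrow> {u \<in> sphere 0 r. \<phi> u = i} \<in> sets (sphere_measure r)"
    using assms by (auto simp: measurable_coloring_def r_def)
  have ps: "p y \<in> sphere 0 r" if "y \<noteq> 0" for y using that r by (simp add: p_def)
  show False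
  proof (rule no_measurable_tetrahedral_coloring[of r "\<phi> \<circ> p"])
    show "(\<phi> \<circ> p) y \<in> {1..4}" if "y \<noteq> 0" for y
      using col(1) ps[OF that] k by (fastforce simp: Pi_iff)
    show "(\<phi> \<circ> p) u \<noteq> (\<phi> \<circ> p) v"
      if uv: "u \<noteq> 0" "v \<noteq> 0" "u \<bullet> v = - (norm u * norm v) / 3" for u v
    proof -
      have "p u \<bullet> p v = r\<^sup>2 / (norm u * norm v) * (u \<bullet> v)" by (simp add: p_def power2_eq_square mult_ac)
      also have "\<dots> = - r\<^sup>2 / 3" using uv by simp
      finally have "p u \<bullet> p v = - r\<^sup>2 / 3" .
      moreover have "p u \<bullet> p u = r\<^sup>2" "p v \<bullet> p v = r\<^sup>2"
        using ps[OF uv(1)] ps[OF uv(2)] by (simp_all add: dot_square_norm)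
      ultimately have "(dist (p u) (p v))\<^sup>2 = 1"
        using r by (simp add: dist_norm power2_norm_eq_inner inner_diff_left inner_diff_right inner_commute)
      then have "dist (p u) (p v) = 1" using zero_le_dist[of "p u" "p v"] by (auto simp: power2_eq_1_iff simp del: zero_le_dist)
      then show ?thesis using col(2) ps uv by simp
    qed
    show "{y \<in> cball 0 r - {0}. (\<phi> \<circ> p) y = i} \<in> sets lebesgue" for i
    proof (cases "i \<in> {1..k}")
      case True
      have "{y \<in> cball 0 r - {0}. p y \<in> {u \<in> sphere 0 r. \<phi> u = i}} = {y \<in> cball 0 r - {0}. (\<phi> \<circ> p) y = i}"
        using ps by auto
      then show ?thesis using sphere_measurable_cone[OF r(1) col(3)[OF True]] by (simp add: p_def)
    next
      case False
      then have "{y \<in> cball 0 r - {0}. (\<phi> \<circ> p) y = i} = {}"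
        using col(1) ps by (auto simp: Pi_iff)
      then show ?thesis by (simp only: sets.empty_sets)
    qed
  qed (rule r)
qed

section \<open>Coloring the orthogonality graph by octants\<close>

text \<open>
  Color \<open>i \<le> 3\<close> is the pair of opposite octants in which coordinate \<open>i\<close> has the sign opposite to the
  others, with those of its boundary points that have a nonzero coordinate \<open>i\<close> and no smaller color. Color 4
  is left with the vectors that have weakly one sign and at least two nonzero coordinates. Vectors in a
  common closed octant, up to sign, are orthogonal only if their supports are disjoint, which neither
  description permits.
\<close>

definition octant_color :: "real^3 \<Rightarrow> nat" where
  "octant_color u =
    (if u$1 \<noteq> 0 \<and> u$1 * u$2 \<le> 0 \<and> u$1 * u$3 \<le> 0 then 1
     else if u$2 \<noteq> 0 \<and> u$1 * u$2 \<le> 0 \<and> u$2 * u$3 \<le> 0 then 2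
     else if u$3 \<noteq> 0 \<and> u$1 * u$3 \<le> 0 \<and> u$2 * u$3 \<le> 0 then 3
     else 4)"

lemma opposite_signs_not_orthogonal:
  fixes a b c a' b' c' :: real
  assumes "a \<noteq> 0" "a * b \<le> 0" "a * c \<le> 0" "a' \<noteq> 0" "a' * b' \<le> 0" "a' * c' \<le> 0"
  shows "a * a' + b * b' + c * c' \<noteq> 0"
proof -
  have "0 \<le> (a * b) * (a' * b')" "0 \<le> (a * c) * (a' * c')"
    using assms by (simp_all only: mult_nonpos_nonpos)
  moreover have "0 < (a * a') * (a * a')" using assms by (simp flip: power2_eq_square)
  ultimately have "0 < (a * a') * (a * a' + b * b' + c * c')" by (simp add: algebra_simps)
  then show ?thesis by auto
qed

text \<open>
  Applied to the products of coordinates of two vectors of color 4, this gives disjoint supports.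
\<close>

lemma sum3_eq_0_same_sign:
  fixes a b c :: real
  assumes "a + b + c = 0" "0 \<le> a * b" "0 \<le> a * c" "0 \<le> b * c"
  shows "a = 0 \<and> b = 0 \<and> c = 0"
proof -
  have "(a + b + c)\<^sup>2 = a\<^sup>2 + b\<^sup>2 + c\<^sup>2 + 2 * (a * b) + 2 * (a * c) + 2 * (b * c)"
    by (simp add: power2_eq_square algebra_simps)
  then have "a\<^sup>2 + b\<^sup>2 + c\<^sup>2 \<le> 0" using assms by simp
  then show ?thesis
    by (smt (verit) zero_le_power2 power2_eq_iff zero_eq_power2)
qed

lemma octant_color_4:
  assumes "u \<noteq> 0" "octant_color u = 4"
  shows "u$1 * u$2 \<ge> 0" "u$1 * u$3 \<ge> 0" "u$2 * u$3 \<ge> 0"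
    "u$1 * u$2 > 0 \<or> u$1 * u$3 > 0 \<or> u$2 * u$3 > 0"
proof -
  have *: "u$1 \<noteq> 0 \<or> u$2 \<noteq> 0 \<or> u$3 \<noteq> 0" using assms(1) by (simp add: vec_eq_iff forall_3)
  have **: "u$1 = 0 \<or> u$1 * u$2 > 0 \<or> u$1 * u$3 > 0" "u$2 = 0 \<or> u$1 * u$2 > 0 \<or> u$2 * u$3 > 0"
    "u$3 = 0 \<or> u$1 * u$3 > 0 \<or> u$2 * u$3 > 0"
    using assms(2) by (auto simp: octant_color_def not_le split: if_splits)
  have signs: "\<not> (a * b < 0 \<and> a * c > 0 \<and> b * c > 0)" for a b c :: real
    by (auto simp: mult_less_0_iff zero_less_mult_iff)
  show "u$1 * u$2 \<ge> 0"
    using **(1,2) signs[of "u$1" "u$2" "u$3"] by fastforce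
  show "u$1 * u$3 \<ge> 0"
    using **(1,3) signs[of "u$1" "u$3" "u$2"] by (fastforce simp: mult.commute)
  show "u$2 * u$3 \<ge> 0"
    using **(2,3) signs[of "u$2" "u$3" "u$1"] by (fastforce simp: mult.commute)
  show "u$1 * u$2 > 0 \<or> u$1 * u$3 > 0 \<or> u$2 * u$3 > 0"
    using * ** by blast
qed

lemma octant_color_orthogonal:
  assumes "u \<noteq> 0" "v \<noteq> 0" "u \<bullet> v = 0"
  shows "octant_color u \<noteq> octant_color v"
proof
  assume eq: "octant_color u = octant_color v"
  have dot: "u$1 * v$1 + u$2 * v$2 + u$3 * v$3 = 0"
    using assms(3) by (simp add: inner_vec_def sum_3)
  have "octant_color u = 1 \<or> octant_color u = 2 \<or> octant_color u = 3 \<or> octant_color u = 4"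
    by (simp add: octant_color_def)
  then consider "octant_color u = 1" | "octant_color u = 2" | "octant_color u = 3" | "octant_color u = 4"
    by blast
  then show False
  proof cases
    case 1
    then show False
      using eq dot opposite_signs_not_orthogonal[of "u$1" "u$2" "u$3" "v$1" "v$2" "v$3"]
      by (auto simp: octant_color_def split: if_splits)
  next
    case 2
    then show False
      using eq dot opposite_signs_not_orthogonal[of "u$2" "u$1" "u$3" "v$2" "v$1" "v$3"]
      by (auto simp: octant_color_def ac_simps split: if_splits)
  next
    case 3
    then show False
      using eq dot opposite_signs_not_orthogonal[of "u$3" "u$1" "u$2" "v$3" "v$1" "v$2"]
      by (auto simp: octant_color_def ac_simps split: if_splits)
  next
    case 4
    note u = octant_color_4[OF assms(1) 4] and v = octant_color_4[OF assms(2) 4[unfolded eq]]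
    have "0 \<le> (u$1 * v$1) * (u$2 * v$2)" "0 \<le> (u$1 * v$1) * (u$3 * v$3)" "0 \<le> (u$2 * v$2) * (u$3 * v$3)"
      using mult_nonneg_nonneg[OF u(1) v(1)] mult_nonneg_nonneg[OF u(2) v(2)]
        mult_nonneg_nonneg[OF u(3) v(3)] by (simp_all add: mult_ac)
    from sum3_eq_0_same_sign[OF dot this]
    have "u$1 * v$1 = 0" "u$2 * v$2 = 0" "u$3 * v$3 = 0" by blast+
    then show False using u(4) v(4) by auto
  qed
qed

lemma measurable_coloring_orthogonality_radius:
  "measurable_coloring (1 / sqrt 2) 4 octant_color"
proof -
  define r where "r = 1 / sqrt 2"
  have r: "r > 0" "r\<^sup>2 = 1/2" by (simp_all add: r_def power_divide)
  have "octant_color u \<in> {1..4}" for u by (simp add: octant_color_def)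
  moreover have "octant_color u \<noteq> octant_color v"
    if uv: "u \<in> sphere 0 r" "v \<in> sphere 0 r" "dist u v = 1" for u v
  proof (rule octant_color_orthogonal)
    have "u \<bullet> u = 1/2" "v \<bullet> v = 1/2" using uv r by (simp_all add: dot_square_norm)
    moreover have "(u - v) \<bullet> (u - v) = 1" using uv(3) by (simp add: dist_norm dot_square_norm)
    ultimately show "u \<bullet> v = 0" by (simp add: inner_diff_left inner_diff_right inner_commute)
  qed (use uv r in auto)
  moreover have "{u \<in> sphere 0 r. octant_color u = i} \<in> sets (sphere_measure r)" for i
  proof -
    have c: "(\<lambda>u::real^3. u $ j) \<in> borel_measurable borel" for j
      by (intro borel_measurable_continuous_onI continuous_intros)
    note c[measurable]
    have "octant_color \<in> measurable borel (count_space UNIV)"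
      unfolding octant_color_def[abs_def] by measurable
    then have "octant_color -` {i} \<inter> space borel \<in> sets borel" by (rule measurable_sets) simp
    then have "octant_color -` {i} \<inter> sphere 0 r \<in> sets (restrict_space borel (sphere 0 r))"
      by (auto simp: sets_restrict_space)
    moreover have "octant_color -` {i} \<inter> sphere 0 r = {u \<in> sphere 0 r. octant_color u = i}" by auto
    ultimately show ?thesis
      unfolding sphere_measure_def by (intro sets_completionI_sets) (simp add: sphere_borel_measure_def)
  qed
  ultimately show ?thesis unfolding measurable_coloring_def r_def[symmetric] by blast
qed

section \<open>Non-monotonicity\<close>

lemma measurable_coloring_small_radius:
  assumes "r < 1/2" shows "measurable_coloring r 1 (\<lambda>_. 1)"
proof -
  have "dist u v \<noteq> 1" if "u \<in> sphere 0 r" "v \<in> sphere 0 r" for u v :: "real^3"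
    using that assms norm_triangle_ineq4[of u v] by (simp add: dist_norm)
  moreover have "{u \<in> sphere 0 r. 1 = i} \<in> sets (sphere_measure r)" if "i \<in> {1..1}" for i :: nat
    using sets.top[of "sphere_measure r"] that by (simp add: sphere_def)
  ultimately show ?thesis unfolding measurable_coloring_def by auto
qed

lemma measurable_coloring_radius_half:
  assumes "measurable_coloring (1/2) k \<phi>" shows "k \<ge> 2"
proof -
  define u :: "real^3" where "u = (1/2) *\<^sub>R axis 1 1"
  have u: "u \<in> sphere 0 (1/2)" "- u \<in> sphere 0 (1/2)" by (simp_all add: u_def)
  have "dist u (- u) = 1" by (simp add: dist_norm u_def flip: scaleR_2)
  then have "\<phi> u \<noteq> \<phi> (- u)" "\<phi> u \<in> {1..k}" "\<phi> (- u) \<in> {1..k}"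
    using assms u unfolding measurable_coloring_def by blast+
  then show ?thesis by auto
qed

lemma measurable_chromatic_number_le:
  assumes "measurable_coloring r k \<phi>" shows "measurable_chromatic_number r \<le> enat k"
  unfolding measurable_chromatic_number_def using assms by (intro Inf_lower) auto

lemma le_measurable_chromatic_number:
  assumes "\<And>k \<phi>. measurable_coloring r k \<phi> \<Longrightarrow> m \<le> k"
  shows "enat m \<le> measurable_chromatic_number r"
  unfolding measurable_chromatic_number_def using assms by (intro Inf_greatest) auto

theorem mainTheorem2:
  "\<not> (mono_on {0<..} measurable_chromatic_number \<or>
      antimono_on {0<..} measurable_chromatic_number)"
proof
  assume "mono_on {0<..} measurable_chromatic_number \<or>
      antimono_on {0<..} measurable_chromatic_number"
  then show False
  proof
    assume "mono_on {0<..} measurable_chromatic_number"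
    moreover have "sqrt (3/8) \<le> 1 / sqrt 2"
      using real_sqrt_le_mono[of "3/8" "1/2"] by (simp add: real_sqrt_divide)
    ultimately have "measurable_chromatic_number (sqrt (3/8)) \<le> measurable_chromatic_number (1 / sqrt 2)"
      by (intro mono_onD[where f = measurable_chromatic_number]) auto
    moreover have "enat 5 \<le> measurable_chromatic_number (sqrt (3/8))"
      by (rule le_measurable_chromatic_number) (rule measurable_coloring_tetrahedral_radius)
    moreover have "measurable_chromatic_number (1 / sqrt 2) \<le> enat 4"
      by (rule measurable_chromatic_number_le) (rule measurable_coloring_orthogonality_radius)
    ultimately have "enat 5 \<le> enat 4" by (meson order.trans)
    then show False by simp
  next
    assume "antimono_on {0<..} measurable_chromatic_number"
    then have "measurable_chromatic_number (1/2) \<le> measurable_chromatic_number (1/4)"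
      by (rule monotone_onD) auto
    moreover have "enat 2 \<le> measurable_chromatic_number (1/2)"
      by (rule le_measurable_chromatic_number) (rule measurable_coloring_radius_half)
    moreover have "measurable_chromatic_number (1/4) \<le> enat 1"
      by (rule measurable_chromatic_number_le) (rule measurable_coloring_small_radius, simp)
    ultimately have "enat 2 \<le> enat 1" by (meson order.trans)
    then show False by simp
  qed
qed

end
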